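(* Assume the continuum hypothesis $2^{\omega}=\omega_1$. Then there is an FC-group $G$ with $|G/Z(G)|=\omega_1$ such that $[G:N_G(A)]\le\omega$ for every abelian subgroup $A\le G$.
   Context: A group $G$ is an FC-group if every element of $G$ has only finitely many conjugates, i.e. $[G:C_G(g)]<\omega$ for all $g\in G$. $Z(G)$ denotes the centre of $G$, $N_G(A)$ the normalizer and $C_G(A)$ the centralizer of $A$ in $G$. *)

theory Defs
  imports "HOL-Algebra.Algebra"
begin

unbundle cardinal_syntax

definition center :: "('a, 'b) monoid_scheme \<Rightarrow> 'a set"
  where "center G = {z \<in> carrier G. \<forall>g \<in> carrier G. z \<otimes>\<^bsub>G\<^esub> g = g \<otimes>\<^bsub>G\<^esub> z}"

definition conjugates :: "('a, 'b) monoid_scheme \<Rightarrow> 'a \<Rightarrow> 'a set"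
  where "conjugates G g = {x \<otimes>\<^bsub>G\<^esub> g \<otimes>\<^bsub>G\<^esub> inv\<^bsub>G\<^esub> x | x. x \<in> carrier G}"

locale fc_group = group G for G (structure) +
  assumes finite_conjugates: "g \<in> carrier G \<Longrightarrow> finite (conjugates G g)"

end

theory Submission
  imports Defs "HOL-Library.Z2" "HOL-Library.Function_Algebras" "HOL-Library.Countable_Set_Type"
begin

text \<open>Let \<open>B\<close> be a direct sum of finite spaces \<open>V\<^sub>m\<close> over the field with two elements, with a commutator
  map into the direct product of the spaces of bilinear forms on the \<open>V\<^sub>m\<close> which vanishes only on
  dependent pairs of vectors of each block. An abelian subgroup then projects to at most a
  line in every \<open>V\<^sub>m\<close>. Under CH there are just \<open>\<omega>\<^sub>1\<close> choices \<open>y\<close> of one line per block, and since \<open>dim V\<^sub>m\<close> grows, one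
  finds an uncountable group \<open>A\<close> of functionals on \<open>B\<close> such that for
  each \<open>y\<close> the restrictions of \<open>A\<close> to \<open>y\<close> form a countable set. Let \<open>A\<close> act on \<open>B\<close> by one further
  central bit, the commutator of \<open>a\<close> and \<open>b\<close> being \<open>a b\<close>. The centralizer of an abelian subgroup
  contains all \<open>a\<close> that vanish on the corresponding \<open>y\<close>, and so has countable index.\<close>

text \<open>These rules rewrite bits into bitwise operations and hide the ring structure.\<close>

declare add_bit_eq_xor [simp del] mult_bit_eq_and [simp del]

section \<open>Bit vectors, blocks of coordinates and restriction of functionals\<close>

lemma bit_add_self [simp]: "a + a = 0" for a :: bit
  by (cases a) simp_all

lemma bit_ext: "(\<And>x. f x = 1 \<longleftrightarrow> g x = 1) \<Longrightarrow> f = g" for f g :: "'a \<Rightarrow> bit"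
  by (rule ext) (metis bit.exhaust)

lemma countable_finite_support: "countable {f :: 'a::countable \<Rightarrow> bit. finite {x. f x = 1}}"
proof -
  have "countable ((\<lambda>Y x. (of_bool (x \<in> Y) :: bit)) ` Collect (finite :: 'a set \<Rightarrow> bool))"
    by (intro countable_image countable_Collect_finite)
  moreover have "f = (\<lambda>x. of_bool (x \<in> {x. f x = 1}))" for f :: "'a \<Rightarrow> bit"
    by (rule bit_ext) simp
  ultimately show ?thesis
    by (elim countable_subset[rotated]) blast
qed

text \<open>The index runs up to \<open>2 ^ m\<close> inclusive: this is one coordinate more than
  there are subsets of \<open>{..<m}\<close>, as the pigeonhole argument requires.\<close>

definition dot :: "nat \<Rightarrow> (nat \<Rightarrow> bit) \<Rightarrow> (nat \<Rightarrow> bit) \<Rightarrow> bit"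
  where "dot m u v = (\<Sum>i\<le>2 ^ m. u i * v i)"

lemma dot_add_left: "dot m (u + u') v = dot m u v + dot m u' v"
  by (simp add: dot_def distrib_right sum.distrib)

lemma dot_add_right: "dot m u (v + v') = dot m u v + dot m u v'"
  by (simp add: dot_def distrib_left sum.distrib)

lemma dot_zero [simp]: "dot m 0 v = 0" "dot m u 0 = 0"
  by (simp_all add: dot_def)

lemma dot_of_bool: "i \<le> 2 ^ m \<Longrightarrow> dot m u (\<lambda>l. of_bool (l = i)) = u i"
  by (simp add: dot_def if_distrib of_bool_def cong: if_cong)

definition restr :: "(nat \<Rightarrow> nat \<Rightarrow> bit) \<Rightarrow> (nat \<Rightarrow> nat \<Rightarrow> bit) \<Rightarrow> nat \<Rightarrow> bit"
  where "restr y a = (\<lambda>m. dot m (a m) (y m))"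

lemma restr_add: "restr y (a + a') = restr y a + restr y a'"
  by (rule ext) (simp add: restr_def dot_add_left)

lemma restr_zero [simp]: "restr y 0 = 0"
  by (rule ext) (simp add: restr_def)

lemma restr_sum_list: "restr y (sum_list xs) = sum_list (map (restr y) xs)"
  by (induction xs) (simp_all only: list.map sum_list.Nil sum_list.Cons restr_add restr_zero)

text \<open>Vectors and functionals are total functions; cutting them off outside the coordinates
  summed by \<open>dot\<close> ensures that \<open>dot\<close> detects every nonzero
  functional.\<close>

definition block_fun :: "(nat \<Rightarrow> nat \<Rightarrow> bit) \<Rightarrow> bool"
  where "block_fun f \<longleftrightarrow> (\<forall>m i. i > 2 ^ m \<longrightarrow> f m i = 0)"

text \<open>The block with index \<open>m\<close> has more than \<open>2 ^ m\<close> coordinates, so two of them are not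
  separated by the first \<open>m\<close> members of \<open>S\<close>; their sum is the value of \<open>f\<close> there.\<close>

lemma ex_eventually_orthogonal:
  assumes "countable S"
  obtains f where "block_fun f" "\<And>m. f m \<noteq> 0" "\<And>y. y \<in> S \<Longrightarrow> finite {m. restr y f m = 1}"
proof -
  \<comment> \<open>Inserting 0 makes the set nonempty, so that \<open>from_nat_into\<close>
    enumerates it.\<close>
  define y where "y = from_nat_into (insert 0 S)"
  have range: "range y = insert 0 S"
    unfolding y_def using assms by (intro range_from_nat_into) auto
  have "\<exists>i j. i < j \<and> j \<le> 2 ^ m \<and> (\<forall>k<m. y k m i = y k m j)" for m
  proof -
    let ?h = "\<lambda>i. {k. k < m \<and> y k m i = 1}"
    have "card (?h ` {..2 ^ m}) \<le> card (Pow {..<m})"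
      by (intro card_mono) auto
    also have "\<dots> < card {..(2::nat) ^ m}"
      by (simp add: card_Pow)
    finally have "\<not> inj_on ?h {..2 ^ m}"
      by (rule pigeonhole)
    then obtain i j where ij: "i \<le> 2 ^ m" "j \<le> 2 ^ m" "i \<noteq> j" "?h i = ?h j"
      by (auto simp: inj_on_def)
    have "y k m i = y k m j" if "k < m" for k
    proof -
      have "k \<in> ?h i \<longleftrightarrow> k \<in> ?h j"
        by (simp only: ij(4))
      with that have "y k m i = 1 \<longleftrightarrow> y k m j = 1"
        by simp
      then show ?thesis
        by (metis bit.exhaust)
    qed
    then have "\<exists>i j. i < j \<and> j \<le> 2 ^ m \<and> (\<forall>k<m. y k m i = y k m j)"
      if "i < j \<or> j < i"
      using that ij(1,2) by metis
    with ij(3) show ?thesis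
      by (simp add: neq_iff)
  qed
  then have "\<forall>m. \<exists>i j. i < j \<and> j \<le> 2 ^ m \<and> (\<forall>k<m. y k m i = y k m j)"
    by (rule allI)
  then have "\<exists>i j. \<forall>m. i m < j m \<and> j m \<le> 2 ^ m \<and> (\<forall>k<m. y k m (i m) = y k m (j m))"
    by (simp only: choice_iff)
  then obtain i j where ij: "\<And>m. i m < j m" "\<And>m. j m \<le> 2 ^ m"
      "\<And>m k. k < m \<Longrightarrow> y k m (i m) = y k m (j m)"
    by blast
  define f :: "nat \<Rightarrow> nat \<Rightarrow> bit"
    where "f m = (\<lambda>l. of_bool (l = i m)) + (\<lambda>l. of_bool (l = j m))" for m
  show thesis
  proof
    show "block_fun f"
      unfolding block_fun_def
    proof (intro allI impI)
      fix m l :: nat assume "2 ^ m < l"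
      then have "i m < l" "j m < l"
        using ij(1)[of m] ij(2)[of m] by linarith+
      then show "f m l = 0"
        by (simp add: f_def)
    qed
    show "f m \<noteq> 0" for m
    proof -
      have "f m (i m) = 1"
        using ij(1)[of m] by (simp add: f_def)
      then show ?thesis
        by auto
    qed
    fix z assume "z \<in> S"
    then obtain k where k: "z = y k"
      using range by blast
    have comm: "dot m u v = dot m v u" for m u v
      by (simp add: dot_def mult.commute)
    \<comment> \<open>The pairing of \<open>y k m\<close> with \<open>f m\<close> is a sum of two
      equal bits, hence 0.\<close>
    have "restr z f m = 0" if "k < m" for m
      using ij[of m] ij(3)[OF that] unfolding restr_def k
      by (subst comm) (simp add: f_def dot_add_right dot_of_bool)
    then have "{m. restr z f m = 1} \<subseteq> {..k}"
      by (force simp: not_less[symmetric])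
    then show "finite {m. restr z f m = 1}"
      by (rule finite_subset) simp
  qed
qed

section \<open>The continuum, and the functionals obtained from CH\<close>

lemma card_UNIV_nat_set: "|UNIV :: nat set set| =o ctwo ^c natLeq"
proof -
  have "|UNIV :: nat set set| =o |Func (UNIV :: nat set) (UNIV :: bool set)|"
    using card_of_Pow_Func[of "UNIV :: nat set"] by simp
  then show ?thesis
    by (simp add: cexp_def ctwo_def Field_natLeq Field_card_of)
qed

text \<open>Transfers CH to the type of the candidates \<open>y\<close>. One injection codes the set
  of arguments with value 1, the other makes a set into a function constant in its second
  argument.\<close>

lemma card_UNIV_nat_nat_bit: "|UNIV :: (nat \<Rightarrow> nat \<Rightarrow> bit) set| =o |UNIV :: nat set set|"
proof (rule ordIso_iff_ordLeq[THEN iffD2], intro conjI)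
  let ?e = "\<lambda>f :: nat \<Rightarrow> nat \<Rightarrow> bit. {n. f (fst (prod_decode n)) (snd (prod_decode n)) = 1}"
  have "inj ?e"
  proof (rule injI, intro ext)
    fix f g :: "nat \<Rightarrow> nat \<Rightarrow> bit" and m i
    assume "?e f = ?e g"
    then have "prod_encode (m, i) \<in> ?e f \<longleftrightarrow> prod_encode (m, i) \<in> ?e g"
      by (rule arg_cong)
    then have "f m i = 1 \<longleftrightarrow> g m i = 1"
      by simp
    then show "f m i = g m i"
      by (metis bit.exhaust)
  qed
  then show "|UNIV :: (nat \<Rightarrow> nat \<Rightarrow> bit) set| \<le>o |UNIV :: nat set set|"
    by (rule card_of_ordLeqI) simp
  let ?d = "\<lambda>(Y :: nat set) m (i :: nat). of_bool (m \<in> Y) :: bit"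
  have "inj ?d"
  proof (rule injI, rule Set.set_eqI)
    fix Y Z m assume "?d Y = ?d Z"
    then have "?d Y m 0 = ?d Z m 0"
      by (rule fun_cong[OF fun_cong])
    then show "m \<in> Y \<longleftrightarrow> m \<in> Z"
      by (simp only: of_bool_eq_iff)
  qed
  then show "|UNIV :: nat set set| \<le>o |UNIV :: (nat \<Rightarrow> nat \<Rightarrow> bit) set|"
    by (rule card_of_ordLeqI) simp
qed

text \<open>Well-order all candidates \<open>y\<close> in type \<open>\<omega>\<^sub>1\<close> and let \<open>\<phi> x\<close> be eventually orthogonal to all
  \<open>y \<le> x\<close>. A fixed \<open>f\<close> cannot equal \<open>\<phi> x\<close> for uncountably many \<open>x\<close>, since some \<open>y\<close> pairs
  to 1 with \<open>f\<close> in every block.\<close>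

lemma CH_ex_functionals:
  assumes CH: "ctwo ^c natLeq =o cardSuc natLeq"
  obtains \<Phi> where "uncountable \<Phi>" "\<And>f. f \<in> \<Phi> \<Longrightarrow> block_fun f" "\<And>y. countable (restr y ` \<Phi>)"
proof -
  let ?r = "|UNIV :: (nat \<Rightarrow> nat \<Rightarrow> bit) set|"
  have r: "?r =o cardSuc natLeq"
    by (intro ordIso_transitive[OF card_UNIV_nat_nat_bit] ordIso_transitive[OF card_UNIV_nat_set] CH)
  \<comment> \<open>A proper initial segment of a cardinal order of size
    \<open>cardSuc natLeq\<close> is strictly smaller, hence countable.\<close>
  have countable_underS: "countable (underS ?r x)" for x
  proof -
    have "|underS ?r x| <o ?r"
      by (rule card_of_underS) (simp_all add: card_of_Card_order Field_card_of)
    then have "|underS ?r x| <o cardSuc natLeq"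
      using r by (rule ordLess_ordIso_trans)
    then show ?thesis
      by (simp add: cardSuc_ordLess_ordLeq card_of_Card_order natLeq_Card_order
          countable_card_le_natLeq)
  qed
  have uncountable_UNIV: "uncountable (UNIV :: (nat \<Rightarrow> nat \<Rightarrow> bit) set)"
  proof
    assume "countable (UNIV :: (nat \<Rightarrow> nat \<Rightarrow> bit) set)"
    then have "?r \<le>o natLeq"
      by (simp only: countable_card_le_natLeq)
    then have "cardSuc natLeq \<le>o natLeq"
      using r ordIso_ordLeq_trans ordIso_symmetric by blast
    then show False
      using cardSuc_greater[OF natLeq_Card_order] not_ordLess_ordLeq by blast
  qed
  have total: "y \<in> insert x (underS ?r x) \<or> x \<in> underS ?r y" for x y
    using card_of_well_order_on[of "UNIV :: (nat \<Rightarrow> nat \<Rightarrow> bit) set"]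
    unfolding well_order_on_def linear_order_on_def total_on_def underS_def by blast
  have "\<forall>x. \<exists>f. block_fun f \<and> (\<forall>m. f m \<noteq> 0) \<and>
      (\<forall>y \<in> insert x (underS ?r x). finite {m. restr y f m = 1})"
    using ex_eventually_orthogonal[OF countable_insert[OF countable_underS]] by metis
  from choice[OF this] obtain \<phi> where \<phi>_all: "\<forall>x. block_fun (\<phi> x) \<and> (\<forall>m. \<phi> x m \<noteq> 0) \<and>
      (\<forall>y \<in> insert x (underS ?r x). finite {m. restr y (\<phi> x) m = 1})" ..
  note \<phi> = \<phi>_all[THEN spec, THEN conjunct1]
    \<phi>_all[THEN spec, THEN conjunct2, THEN conjunct1, THEN spec]
    \<phi>_all[THEN spec, THEN conjunct2, THEN conjunct2, THEN bspec]
  show thesis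
  proof
    fix y
    \<comment> \<open>The \<open>x\<close> above or equal to \<open>y\<close> give finite supports,
      of which there are only countably many; the other \<open>x\<close> form a countable initial
      segment.\<close>
    have "restr y ` range \<phi> \<subseteq> {f. finite {m. f m = 1}} \<union> restr y ` \<phi> ` underS ?r y"
      using total \<phi>(3) by blast
    then show "countable (restr y ` range \<phi>)"
      by (rule countable_subset)
        (intro countable_Un countable_finite_support countable_image countable_underS)
  next
    have fiber: "countable {x. \<phi> x = \<phi> x0}" for x0
    proof -
      have "\<exists>i. i \<le> 2 ^ m \<and> \<phi> x0 m i = 1" for m
      proof -
        have "\<exists>i. \<phi> x0 m i \<noteq> 0"
          using \<phi>(2)[of x0 m] by (auto simp only: fun_eq_iff zero_fun_apply)
        then show ?thesis
          using \<phi>(1)[of x0] unfolding block_fun_def by (metis bit.exhaust not_le)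
      qed
      then obtain i where i: "\<And>m. i m \<le> 2 ^ m" "\<And>m. \<phi> x0 m (i m) = 1"
        by metis
      \<comment> \<open>In each block, the unit vector at a coordinate where
        \<open>\<phi> x0\<close> is 1.\<close>
      define y :: "nat \<Rightarrow> nat \<Rightarrow> bit" where "y = (\<lambda>m l. of_bool (l = i m))"
      have "restr y (\<phi> x0) m = 1" for m
        using i by (simp add: restr_def y_def dot_of_bool)
      then have "infinite {m. restr y (\<phi> x0) m = 1}"
        by simp
      \<comment> \<open>Eventual orthogonality fails for this \<open>y\<close>, so the whole fibre
        lies strictly below \<open>y\<close>.\<close>
      then have "y \<notin> insert x (underS ?r x)" if "\<phi> x = \<phi> x0" for x
        using \<phi>(3)[of y x] that by (simp only:) blast
      then have "{x. \<phi> x = \<phi> x0} \<subseteq> underS ?r y"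
        using total by blast
      then show ?thesis
        using countable_underS countable_subset by blast
    qed
    show "uncountable (range \<phi>)"
    proof
      assume "countable (range \<phi>)"
      then have "countable (\<Union>f \<in> range \<phi>. {x. \<phi> x = f})"
        using fiber by (intro countable_UN) auto
      moreover have "(\<Union>f \<in> range \<phi>. {x. \<phi> x = f}) = UNIV"
        by auto
      ultimately show False
        using uncountable_UNIV by simp
    qed
  qed (use \<phi>(1) in auto)
qed

lemma block_fun_zero: "block_fun 0"
  by (simp add: block_fun_def)

lemma block_fun_add: "block_fun f \<Longrightarrow> block_fun g \<Longrightarrow> block_fun (f + g)"
  by (simp add: block_fun_def)

text \<open>Take all finite sums: they restrict to finite sums over a countable set of restrictions.
  In characteristic 2, closure under addition together with 0 gives a group.\<close>

lemma CH_ex_functional_group: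
  assumes CH: "ctwo ^c natLeq =o cardSuc natLeq"
  obtains A where "uncountable A" "0 \<in> A" "\<And>a b. a \<in> A \<Longrightarrow> b \<in> A \<Longrightarrow> a + b \<in> A"
    "\<And>a. a \<in> A \<Longrightarrow> block_fun a" "\<And>y. countable (restr y ` A)"
proof -
  obtain \<Phi> where \<Phi>: "uncountable \<Phi>" "\<And>f. f \<in> \<Phi> \<Longrightarrow> block_fun f" "\<And>y. countable (restr y ` \<Phi>)"
    using CH_ex_functionals[OF CH] by blast
  define A where "A = sum_list ` lists \<Phi>"
  show thesis
  proof
    have "\<Phi> \<subseteq> A"
    proof
      fix f assume "f \<in> \<Phi>"
      then have "[f] \<in> lists \<Phi>"
        by simp
      then have "sum_list [f] \<in> A"
        unfolding A_def by (rule imageI)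
      then show "f \<in> A"
        by (simp only: sum_list.Cons sum_list.Nil add_0_right)
    qed
    then show "uncountable A"
      using \<Phi>(1) countable_subset by blast
    have "sum_list [] \<in> A"
      unfolding A_def by (rule imageI) simp
    then show "0 \<in> A"
      by (simp only: sum_list.Nil)
    show "a + b \<in> A" if a: "a \<in> A" and b: "b \<in> A" for a b
    proof -
      obtain xs ys where "xs \<in> lists \<Phi>" "a = sum_list xs" "ys \<in> lists \<Phi>" "b = sum_list ys"
        using a b unfolding A_def by blast
      then have "a + b = sum_list (xs @ ys)" "xs @ ys \<in> lists \<Phi>"
        by (simp_all only: sum_list_append append_in_lists_conv)
      then show ?thesis
        unfolding A_def by blast
    qed
    show "block_fun a" if a: "a \<in> A" for a
    proof -
      obtain xs where "a = sum_list xs" "xs \<in> lists \<Phi>"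
        using a unfolding A_def by (rule imageE)
      moreover have "xs \<in> lists \<Phi> \<Longrightarrow> block_fun (sum_list xs)" for xs
        by (induction xs) (simp_all only: sum_list.Nil sum_list.Cons block_fun_zero block_fun_add \<Phi>(2) Cons_in_lists_iff)
      ultimately show ?thesis
        by blast
    qed
    fix y
    have "restr y ` A \<subseteq> sum_list ` lists (restr y ` \<Phi>)"
      unfolding A_def by (simp only: lists_image image_image restr_sum_list order_refl)
    then show "countable (restr y ` A)"
      by (rule countable_subset) (intro countable_image countable_lists \<Phi>(3))
  qed
qed

section \<open>The direct sum of the blocks, its pairing with functionals and the block
  commutator\<close>

definition finblock :: "(nat \<Rightarrow> nat \<Rightarrow> bit) \<Rightarrow> bool"
  where "finblock b \<longleftrightarrow> block_fun b \<and> finite {m. b m \<noteq> 0}"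

lemma finblock_zero: "finblock 0"
  by (simp add: finblock_def block_fun_zero)

lemma finblock_add:
  assumes "finblock b" "finblock b'"
  shows "finblock (b + b')"
proof -
  have "{m. (b + b') m \<noteq> 0} \<subseteq> {m. b m \<noteq> 0} \<union> {m. b' m \<noteq> 0}"
    by (intro subsetI) (simp only: mem_Collect_eq Un_iff plus_fun_apply, metis add_0)
  then show ?thesis
    using assms finite_subset unfolding finblock_def by (blast intro: block_fun_add)
qed

text \<open>Finitely many nonzero blocks have finitely many coordinates each. Both the countability
  of the direct sum and the finiteness of conjugacy classes rest on this.\<close>

lemma finite_support_finblock:
  assumes "finblock b"
  shows "finite {(m, i). b m i = 1}"
proof (rule finite_subset)
  show "finite (SIGMA m : {m. b m \<noteq> 0}. {..(2 :: nat) ^ m})"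
    using assms by (simp add: finblock_def)
  show "{(m, i). b m i = 1} \<subseteq> (SIGMA m : {m. b m \<noteq> 0}. {..2 ^ m})"
  proof (rule subrelI, intro SigmaI CollectI)
    fix m i assume "(m, i) \<in> {(m, i). b m i = 1}"
    then have 1: "b m i = 1"
      by simp
    then show "b m \<noteq> 0"
      by (metis zero_fun_apply zero_neq_one)
    show "i \<in> {..2 ^ m}"
      using assms 1 unfolding finblock_def block_fun_def by (metis atMost_iff not_le zero_neq_one)
  qed
qed

lemma countable_finblock: "countable {b. finblock b}"
proof -
  have "{b. finblock b} \<subseteq> curry ` {f. finite {x. f x = 1}}"
  proof
    fix b assume "b \<in> {b. finblock b}"
    then have "finite {x. (case x of (m, i) \<Rightarrow> b m i) = 1}"
      using finite_support_finblock[of b] by (simp add: case_prod_unfold)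
    then show "b \<in> curry ` {f. finite {x. f x = 1}}"
      by (intro image_eqI[of _ _ "case_prod b"]) simp_all
  qed
  then show ?thesis
    by (rule countable_subset) (intro countable_image countable_finite_support)
qed

text \<open>The sum follows the nonzero blocks of \<open>b\<close> because \<open>a\<close> may be
  nonzero in all blocks. An infinite index set would give the default 0, so additivity in
  \<open>b\<close> is stated for \<open>finblock\<close>.\<close>

definition pair :: "(nat \<Rightarrow> nat \<Rightarrow> bit) \<Rightarrow> (nat \<Rightarrow> nat \<Rightarrow> bit) \<Rightarrow> bit"
  where "pair a b = (\<Sum>m | b m \<noteq> 0. dot m (a m) (b m))"

lemma pair_eq_sum:
  assumes "finite M" "{m. b m \<noteq> 0} \<subseteq> M"
  shows "pair a b = (\<Sum>m\<in>M. dot m (a m) (b m))"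
  unfolding pair_def using assms by (intro sum.mono_neutral_left) auto

lemma pair_add_left: "pair (a + a') b = pair a b + pair a' b"
  by (simp only: pair_def plus_fun_apply dot_add_left sum.distrib)

lemma pair_add_right:
  assumes "finblock b" "finblock b'"
  shows "pair a (b + b') = pair a b + pair a b'"
proof -
  let ?M = "{m. b m \<noteq> 0} \<union> {m. b' m \<noteq> 0}"
  have M: "finite ?M" "{m. b m \<noteq> 0} \<subseteq> ?M" "{m. b' m \<noteq> 0} \<subseteq> ?M"
    using assms by (auto simp only: finblock_def)
  have "{m. (b + b') m \<noteq> 0} \<subseteq> ?M"
    by (intro subsetI) (simp only: mem_Collect_eq Un_iff plus_fun_apply, metis add_0)
  then show ?thesis
    using M by (simp only: pair_eq_sum[of ?M] plus_fun_apply dot_add_right sum.distrib)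
qed

lemma pair_zero [simp]: "pair 0 b = 0" "pair a 0 = 0"
  by (simp_all add: pair_def)

text \<open>A cocycle rather than the commutator itself: the commutator is \<open>outer b b' - outer b' b\<close>.\<close>

definition outer :: "(nat \<Rightarrow> nat \<Rightarrow> bit) \<Rightarrow> (nat \<Rightarrow> nat \<Rightarrow> bit) \<Rightarrow> nat \<times> nat \<times> nat \<Rightarrow> bit"
  where "outer b b' = (\<lambda>(m, i, j). b m i * b' m j)"

lemma outer_add_left: "outer (b + b') d = outer b d + outer b' d"
  by (rule ext) (simp add: outer_def distrib_right split: prod.split)

lemma outer_add_right: "outer d (b + b') = outer d b + outer d b'"
  by (rule ext) (simp add: outer_def distrib_left split: prod.split)

lemma outer_zero [simp]: "outer 0 b = 0" "outer b 0 = 0"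
  by (rule ext, simp add: outer_def split: prod.split)+

text \<open>Symmetry forces a coordinate \<open>i\<close> where both vectors are 1, and then
  comparison of the rows at \<open>i\<close> identifies them: over two elements a line has one
  nonzero vector.\<close>

lemma outer_commute_imp_eq:
  assumes comm: "outer b b' = outer b' b" and nz: "b m \<noteq> 0" "b' m \<noteq> 0"
  shows "b m = b' m"
proof -
  have eq: "b m i * b' m j = b' m i * b m j" for i j
    using fun_cong[OF comm, of "(m, i, j)"] by (simp add: outer_def)
  obtain i where i: "b m i = 1"
    using nz(1) by (metis bit.exhaust ext zero_fun_apply)
  obtain k where k: "b' m k = 1"
    using nz(2) by (metis bit.exhaust ext zero_fun_apply)
  have "b' m i = 1"
    using eq[of i k] i k by (metis bit.exhaust mult_1 mult_zero_left zero_neq_one)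
  with eq[of i] i show ?thesis
    by (intro ext) simp
qed

section \<open>The group of quadruples, coded by sets of natural numbers\<close>

type_synonym quad =
  "(nat \<Rightarrow> nat \<Rightarrow> bit) \<times> (nat \<Rightarrow> nat \<Rightarrow> bit) \<times> (nat \<times> nat \<times> nat \<Rightarrow> bit) \<times> bit"

text \<open>The pairs \<open>(a, b)\<close> are extended by central \<open>(w, c)\<close>;
  \<open>outer b b'\<close> and \<open>pair a b'\<close> are the cocycles, and their asymmetry makes
  the product noncommutative.\<close>

fun mul :: "quad \<Rightarrow> quad \<Rightarrow> quad" where
  "mul (a, b, w, c) (a', b', w', c') =
     (a + a', b + b', w + w' + outer b b', c + c' + pair a b')"

text \<open>Coding puts the group on \<open>nat set\<close>, whose cardinality bounds the quotient.
  The tag \<open>k\<close> selects the component, all tags from 3 on giving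
  \<open>c\<close>.\<close>

definition code :: "quad \<Rightarrow> nat set" where
  "code = (\<lambda>(a, b, w, c). {n. case from_nat n of (k :: nat, m, i, j) \<Rightarrow>
     (if k = 0 then a m i else if k = 1 then b m i else if k = 2 then w (m, i, j) else c) = 1})"

lemma inj_code: "inj code"
proof (rule injI)
  fix p q assume eq: "code p = code q"
  obtain a b w c where p: "p = (a, b, w, c)"
    by (cases p)
  obtain a' b' w' c' where q: "q = (a', b', w', c')"
    by (cases q)
  have "to_nat (k, m, i, j) \<in> code p \<longleftrightarrow> to_nat (k, m, i, j) \<in> code q" for k m i j :: nat
    by (simp only: eq)
  then have *: "(if k = 0 then a m i else if k = 1 then b m i else if k = 2 then w (m, i, j) else c) = 1 \<longleftrightarrow>
     (if k = 0 then a' m i else if k = 1 then b' m i else if k = 2 then w' (m, i, j) else c') = 1"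
    for k m i j :: nat
    unfolding p q code_def by (simp only: prod.case mem_Collect_eq from_nat_to_nat)
  have "a = a'"
    by (intro ext[of a] bit_ext) (use *[of 0] in simp)
  moreover have "b = b'"
    by (intro ext[of b] bit_ext) (use *[of 1] in simp)
  moreover have "w = w'"
    by (rule bit_ext) (use *[of 2] in auto)
  moreover have "c = c'"
  proof -
    have "c = 1 \<longleftrightarrow> c' = 1"
      using *[of 3] by simp
    then show ?thesis
      by (metis bit.exhaust)
  qed
  ultimately show "p = q"
    by (simp only: p q)
qed

lemma fun_add_self [simp]: "f + f = 0" for f :: "'a \<Rightarrow> bit"
  by (rule ext) simp

lemma fun2_add_self [simp]: "f + f = 0" for f :: "'a \<Rightarrow> 'b \<Rightarrow> bit"
  by (rule ext) (simp only: plus_fun_apply fun_add_self zero_fun_apply)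

text \<open>The cocycle terms of both sides agree by biadditivity; the assumptions serve
  \<open>pair_add_right\<close>.\<close>

lemma mul_assoc:
  assumes "finblock (fst (snd q))" "finblock (fst (snd r))"
  shows "mul (mul p q) r = mul p (mul q r)"
  using assms
  by (cases p; cases q; cases r)
    (simp add: pair_add_left pair_add_right outer_add_left outer_add_right ac_simps)

text \<open>Addition is commutative, so the two products can differ only in the cocycle
  values.\<close>

lemma mul_commute_iff:
  "mul (a, b, w, c) (a', b', w', c') = mul (a', b', w', c') (a, b, w, c) \<longleftrightarrow>
     outer b b' = outer b' b \<and> pair a b' = pair a' b"
  by (simp add: add.commute[of a'] add.commute[of b'] add.commute[of w'] add.commute[of c'])

definition quads :: "(nat \<Rightarrow> nat \<Rightarrow> bit) set \<Rightarrow> quad set"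
  where "quads A = {(a, b, w, c). a \<in> A \<and> finblock b}"

definition quad_group :: "(nat \<Rightarrow> nat \<Rightarrow> bit) set \<Rightarrow> nat set monoid" where
  "quad_group A = \<lparr>carrier = code ` quads A,
     monoid.mult = \<lambda>x y. code (mul (the_inv code x) (the_inv code y)), one = code (0, 0, 0, 0)\<rparr>"

lemma quad_group_mult: "code p \<otimes>\<^bsub>quad_group A\<^esub> code q = code (mul p q)"
  by (simp add: quad_group_def the_inv_f_f[OF inj_code])

lemma quad_group_carrierE:
  assumes "x \<in> carrier (quad_group A)"
  obtains a b w c where "x = code (a, b, w, c)" "a \<in> A" "finblock b"
  using assms by (auto simp: quad_group_def quads_def)

lemma quad_group_carrierI: "a \<in> A \<Longrightarrow> finblock b \<Longrightarrow> code (a, b, w, c) \<in> carrier (quad_group A)"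
  by (simp add: quad_group_def quads_def)

lemma code_eq_iff: "code p = code q \<longleftrightarrow> p = q"
  by (rule inj_eq[OF inj_code])

lemma group_quad_group:
  assumes zero: "0 \<in> A" and add: "\<And>a b. a \<in> A \<Longrightarrow> b \<in> A \<Longrightarrow> a + b \<in> A"
  shows "group (quad_group A)"
proof (rule groupI)
  have one: "\<one>\<^bsub>quad_group A\<^esub> = code (0, 0, 0, 0)"
    by (simp add: quad_group_def)
  show "\<one>\<^bsub>quad_group A\<^esub> \<in> carrier (quad_group A)"
    unfolding one by (intro quad_group_carrierI zero finblock_zero)
  fix x assume x: "x \<in> carrier (quad_group A)"
  then obtain a b w c where x': "x = code (a, b, w, c)" "a \<in> A" "finblock b"
    by (rule quad_group_carrierE)
  show "\<one>\<^bsub>quad_group A\<^esub> \<otimes>\<^bsub>quad_group A\<^esub> x = x"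
    by (simp add: one x'(1) quad_group_mult)
  show "\<exists>y \<in> carrier (quad_group A). y \<otimes>\<^bsub>quad_group A\<^esub> x = \<one>\<^bsub>quad_group A\<^esub>"
  proof (rule bexI)
    \<comment> \<open>Each \<open>a\<close> and \<open>b\<close> is its own inverse; the corrections
      \<open>outer b b\<close> and \<open>pair a b\<close> cancel the cocycle values added by the
      product.\<close>
    have "w + outer b b + w + outer b b = 0" "c + pair a b + c + pair a b = 0"
      by (simp_all only: add.assoc add.left_commute[of w "outer b b"] fun_add_self
          add.left_commute[of "pair a b" c "pair a b"] bit_add_self add.commute[of "outer b b" w]
          add.left_commute[of "outer b b" w "outer b b"] add_0_right)
    then show "code (a, b, w + outer b b, c + pair a b) \<otimes>\<^bsub>quad_group A\<^esub> x = \<one>\<^bsub>quad_group A\<^esub>"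
      by (simp only: one x'(1) quad_group_mult mul.simps fun2_add_self)
    show "code (a, b, w + outer b b, c + pair a b) \<in> carrier (quad_group A)"
      by (intro quad_group_carrierI x')
  qed
  fix y assume y: "y \<in> carrier (quad_group A)"
  then obtain a' b' w' c' where y': "y = code (a', b', w', c')" "a' \<in> A" "finblock b'"
    by (rule quad_group_carrierE)
  show "x \<otimes>\<^bsub>quad_group A\<^esub> y \<in> carrier (quad_group A)"
    using x' y' by (simp add: quad_group_mult quad_group_carrierI add finblock_add)
  fix z assume z: "z \<in> carrier (quad_group A)"
  then obtain a'' b'' w'' c'' where z': "z = code (a'', b'', w'', c'')" "a'' \<in> A" "finblock b''"
    by (rule quad_group_carrierE)
  show "x \<otimes>\<^bsub>quad_group A\<^esub> y \<otimes>\<^bsub>quad_group A\<^esub> z = x \<otimes>\<^bsub>quad_group A\<^esub> (y \<otimes>\<^bsub>quad_group A\<^esub> z)"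
    using y'(3) z'(3) by (simp only: x'(1) y'(1) z'(1) quad_group_mult code_eq_iff)
      (rule mul_assoc, simp_all only: fst_conv snd_conv)
qed

section \<open>Normalizers and cosets in arbitrary groups\<close>

lemma (in group) centralizing_in_normalizer:
  assumes "H \<subseteq> carrier G" "x \<in> carrier G" "\<And>h. h \<in> H \<Longrightarrow> x \<otimes> h = h \<otimes> x"
  shows "x \<in> normalizer G H"
proof -
  have "x \<otimes> h \<otimes> inv x = h" if "h \<in> H" for h
    using assms that by (metis inv_solve_right m_closed subsetD)
  then have "x <# H #> inv x = H"
    by (auto simp: l_coset_def r_coset_def)
  then show ?thesis
    using assms by (simp add: normalizer_def stabilizer_def)
qed

text \<open>Each fibre of \<open>f\<close> lies in a single coset, so one representative per value
  of \<open>f\<close> reaches all cosets.\<close>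

lemma (in group) countable_rcosets:
  assumes "subgroup N G" and "countable (f ` carrier G)"
    and f: "\<And>x y. x \<in> carrier G \<Longrightarrow> y \<in> carrier G \<Longrightarrow> f x = f y \<Longrightarrow> x \<otimes> inv y \<in> N"
  shows "countable (rcosets N)"
proof -
  have "N #> x = N #> y" if "x \<in> carrier G" "y \<in> carrier G" "f x = f y" for x y
    using coset_mult_inv1[OF coset_join2[OF _ assms(1) f[OF that]] that(1,2)] that
      subgroup.subset[OF assms(1)] by simp
  then have "N #> x = N #> inv_into (carrier G) f (f x)" if "x \<in> carrier G" for x
    using that by (metis f_inv_into_f image_eqI inv_into_into)
  then have "rcosets N \<subseteq> (\<lambda>v. N #> inv_into (carrier G) f v) ` f ` carrier G"
    by (auto simp: RCOSETS_def)
  then show ?thesis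
    by (rule countable_subset) (intro countable_image assms(2))
qed

section \<open>Conjugacy classes, central quotient and normalizers of the group\<close>

lemma fc_group_quad_group:
  assumes zero: "0 \<in> A" and add: "\<And>a b. a \<in> A \<Longrightarrow> b \<in> A \<Longrightarrow> a + b \<in> A"
  shows "fc_group (quad_group A)"
proof -
  interpret group "quad_group A"
    by (intro group_quad_group zero add)
  show ?thesis
  proof
    fix g assume g: "g \<in> carrier (quad_group A)"
    then obtain a b w c where g': "g = code (a, b, w, c)" "a \<in> A" "finblock b"
      by (rule quad_group_carrierE)
    \<comment> \<open>Triples over the blocks where \<open>b\<close> is nonzero: commutators with
      \<open>g\<close> have their third component supported here.\<close>
    define S where "S = {(m, i :: nat, j :: nat). (\<exists>l. b m l = 1) \<and> i \<le> 2 ^ m \<and> j \<le> 2 ^ m}"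
    have "finite (SIGMA m : fst ` {(m, i). b m i = 1}. {..(2::nat) ^ m} \<times> {..(2::nat) ^ m})"
      using finite_support_finblock[OF g'(3)] by simp
    then have "finite S"
      by (rule finite_subset[rotated]) (force simp: S_def)
    define U where "U = {u. \<forall>x. (x \<in> S \<longrightarrow> u x \<in> {0, 1 :: bit}) \<and> (x \<notin> S \<longrightarrow> u x = 0)}"
    have "finite U"
      unfolding U_def using \<open>finite S\<close> by (rule finite_set_of_finite_funs) simp
    \<comment> \<open>Conjugation fixes \<open>a\<close> and \<open>b\<close>, adds to
      \<open>w\<close> a function supported in \<open>S\<close>, and may change the bit
      \<open>c\<close>.\<close>
    have "conjugates (quad_group A) g \<subseteq> code ` ({a} \<times> {b} \<times> (+) w ` U \<times> {0, 1})"
    proof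
      fix k assume "k \<in> conjugates (quad_group A) g"
      then obtain x where x: "x \<in> carrier (quad_group A)"
          "k = x \<otimes>\<^bsub>quad_group A\<^esub> g \<otimes>\<^bsub>quad_group A\<^esub> inv\<^bsub>quad_group A\<^esub> x"
        unfolding conjugates_def by blast
      \<comment> \<open>In the form \<open>k x = x g\<close> the conjugate can be compared without
        computing an inverse.\<close>
      have k: "k \<in> carrier (quad_group A)" "k \<otimes>\<^bsub>quad_group A\<^esub> x = x \<otimes>\<^bsub>quad_group A\<^esub> g"
        using x g by (simp_all add: m_assoc)
      obtain a' b' w' c' where x': "x = code (a', b', w', c')" "finblock b'"
        using x(1) by (rule quad_group_carrierE)
      obtain ka kb kw kc where k': "k = code (ka, kb, kw, kc)"
        using k(1) by (rule quad_group_carrierE)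
      have eq: "ka + a' = a' + a" "kb + b' = b' + b"
          "kw + w' + outer kb b' = w' + w + outer b' b"
        using k(2) unfolding k' x'(1) g'(1) quad_group_mult code_eq_iff mul.simps prod.inject
        by - (elim conjE, assumption)+
      have ka: "ka = a" and kb: "kb = b"
        using eq(1,2) by (simp_all add: add.commute[of a'] add.commute[of b'])
      define u where "u = outer b' b + outer b b'"
      have "kw + (w' + outer b b') = w + u + (w' + outer b b')"
        using eq(3) unfolding kb u_def
        by (simp only: add.assoc add.left_commute[of "outer b b'" w'] fun_add_self add_0_right)
          (simp only: ac_simps)
      then have kw: "kw = w + u"
        by (simp only: add_right_cancel)
      have "u x = 0" if x: "x \<notin> S" for x
      proof -
        obtain m i j where mij: "x = (m, i, j)"
          by (cases x)
        consider "\<And>l. b m l = 0" | "i > 2 ^ m" | "j > 2 ^ m"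
          using x unfolding mij S_def by (auto simp: not_le)
        then show ?thesis
          using x'(2) g'(3) by cases (simp_all add: mij u_def outer_def finblock_def block_fun_def)
      qed
      moreover have "u x \<in> {0, 1}" for x
        using bit.exhaust[of "u x"] by blast
      ultimately have "u \<in> U"
        by (simp only: U_def mem_Collect_eq) blast
      moreover have "kc \<in> {0, 1}"
        using bit.exhaust[of kc] by blast
      ultimately show "k \<in> code ` ({a} \<times> {b} \<times> (+) w ` U \<times> {0, 1})"
        unfolding k' ka kb kw by (intro imageI SigmaI singletonI)
    qed
    then show "finite (conjugates (quad_group A) g)"
      by (rule finite_subset) (simp add: \<open>finite U\<close>)
  qed
qed

text \<open>The elements \<open>(a, 0, 0, 0)\<close> are incongruent modulo the centre: a central
  \<open>z\<close> relating two of them has a first component that pairs to 0 with all unit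
  vectors.\<close>

lemma uncountable_quad_group_mod_center:
  assumes zero: "0 \<in> A" and add: "\<And>a b. a \<in> A \<Longrightarrow> b \<in> A \<Longrightarrow> a + b \<in> A"
    and block: "\<And>a. a \<in> A \<Longrightarrow> block_fun a" and "uncountable A"
  shows "uncountable (carrier (quad_group A Mod center (quad_group A)))"
proof
  let ?G = "quad_group A"
  interpret group ?G
    by (intro group_quad_group zero add)
  define coset where "coset a = center ?G #>\<^bsub>?G\<^esub> code (a, 0, 0, 0)" for a
  have "inj_on coset A"
  proof (rule inj_onI)
    fix a a' assume a: "a \<in> A" "a' \<in> A" and eq: "coset a = coset a'"
    have "\<one>\<^bsub>?G\<^esub> \<in> center ?G"
      by (simp add: center_def)
    moreover have "code (a, 0, 0, 0) = \<one>\<^bsub>?G\<^esub> \<otimes>\<^bsub>?G\<^esub> code (a, 0, 0, 0)"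
      using a by (simp add: quad_group_carrierI finblock_zero)
    ultimately have "code (a, 0, 0, 0) \<in> coset a"
      unfolding coset_def r_coset_def by blast
    then have "code (a, 0, 0, 0) \<in> coset a'"
      by (simp only: eq)
    then obtain z where z: "z \<in> center ?G" "code (a, 0, 0, 0) = z \<otimes>\<^bsub>?G\<^esub> code (a', 0, 0, 0)"
      unfolding coset_def r_coset_def by blast
    have "z \<in> carrier ?G"
      using z(1) by (simp add: center_def)
    then obtain d b w c where z': "z = code (d, b, w, c)" "d \<in> A" "finblock b"
      by (rule quad_group_carrierE)
    have d: "a = d + a'"
      using z(2) unfolding z'(1) quad_group_mult code_eq_iff mul.simps prod.inject
      by (elim conjE)
    have b: "b = 0"
      using z(2) unfolding z'(1) quad_group_mult code_eq_iff mul.simps prod.inject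
      by (simp only: add_0_right)
    have "d m i = 0" for m i
    proof (cases "i \<le> 2 ^ m")
      case True
      \<comment> \<open>The unit vector at \<open>i\<close> in block \<open>m\<close>; its pairing
        with \<open>d\<close> reads off \<open>d m i\<close>.\<close>
      define f :: "nat \<Rightarrow> nat \<Rightarrow> bit" where "f = 0(m := \<lambda>l. of_bool (l = i))"
      have nz: "{k. f k \<noteq> 0} \<subseteq> {m}"
        by (auto simp: f_def)
      have f: "finblock f"
        unfolding finblock_def block_fun_def
      proof (intro conjI allI impI)
        show "f k l = 0" if "2 ^ k < l" for k l
          using that True by (auto simp: f_def)
        show "finite {k. f k \<noteq> 0}"
          using nz by (rule finite_subset) simp
      qed
      have "code (0, f, 0, 0) \<in> carrier ?G"
        by (intro quad_group_carrierI zero f)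
      then have "z \<otimes>\<^bsub>?G\<^esub> code (0, f, 0, 0) = code (0, f, 0, 0) \<otimes>\<^bsub>?G\<^esub> z"
        using z(1) by (simp add: center_def)
      then have "pair d f = pair 0 b"
        unfolding z'(1) quad_group_mult code_eq_iff mul_commute_iff by (elim conjE)
      moreover have "pair d f = dot m (d m) (f m)"
        using pair_eq_sum[OF _ nz, of d] by simp
      moreover have "dot m (d m) (f m) = d m i"
        using True by (simp add: f_def dot_of_bool)
      ultimately show ?thesis
        by simp
    next
      case False
      then show ?thesis
        using block[OF z'(2)] by (simp add: block_fun_def)
    qed
    then have "d = 0"
      by (intro ext) simp
    with d show "a = a'"
      by simp
  qed
  assume "countable (carrier (?G Mod center ?G))"
  moreover have "coset ` A \<subseteq> carrier (?G Mod center ?G)"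
    by (auto simp: FactGroup_def RCOSETS_def coset_def intro!: quad_group_carrierI finblock_zero)
  ultimately have "countable (coset ` A)"
    by (rule countable_subset[rotated])
  then show False
    using \<open>inj_on coset A\<close> \<open>uncountable A\<close> countable_image_inj_on by blast
qed

text \<open>The second components of commuting elements agree in every block where both are nonzero.
  So those of a commutative set are block by block \<open>0\<close> or \<open>y m\<close>, and the set is centralized
  by all elements whose first component restricts to 0 at \<open>y\<close> and whose second component is 0.\<close>

lemma countable_rcosets_normalizer_quad_group:
  assumes zero: "0 \<in> A" and add: "\<And>a b. a \<in> A \<Longrightarrow> b \<in> A \<Longrightarrow> a + b \<in> A"
    and countable: "\<And>y. countable (restr y ` A)"
    and H: "H \<subseteq> carrier (quad_group A)"
    and comm: "\<And>g h. g \<in> H \<Longrightarrow> h \<in> H \<Longrightarrow> g \<otimes>\<^bsub>quad_group A\<^esub> h = h \<otimes>\<^bsub>quad_group A\<^esub> g"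
  shows "countable (rcosets\<^bsub>quad_group A\<^esub> (normalizer (quad_group A) H))"
proof -
  let ?G = "quad_group A"
  interpret group ?G
    by (intro group_quad_group zero add)
  \<comment> \<open>The common nonzero value in block \<open>m\<close> of second components from
    \<open>H\<close>. Where all of them vanish, \<open>SOME\<close> gives an arbitrary vector, which
    is harmless as \<open>y m\<close> is only compared with nonzero \<open>b m\<close>.\<close>
  define y where "y = (\<lambda>m. SOME u. u \<noteq> 0 \<and> (\<exists>a b w c. code (a, b, w, c) \<in> H \<and> b m = u))"
  have y: "b m = y m" if h: "code (a, b, w, c) \<in> H" and nz: "b m \<noteq> 0" for a b w c m
  proof -
    have "\<exists>u. u \<noteq> 0 \<and> (\<exists>a b w c. code (a, b, w, c) \<in> H \<and> b m = u)"
      using h nz by blast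
    then have "y m \<noteq> 0 \<and> (\<exists>a b w c. code (a, b, w, c) \<in> H \<and> b m = y m)"
      unfolding y_def by (rule someI_ex)
    then obtain a' b' w' c' where h': "code (a', b', w', c') \<in> H" "b' m = y m" "b' m \<noteq> 0"
      by auto
    have "outer b b' = outer b' b"
      using comm[OF h h'(1)] unfolding quad_group_mult code_eq_iff mul_commute_iff by (elim conjE)
    then have "b m = b' m"
      using nz h'(3) by (rule outer_commute_imp_eq)
    with h'(2) show ?thesis
      by simp
  qed
  \<comment> \<open>Equal values at \<open>g\<close> and \<open>h\<close> force their quotient to
    have first component restricting to 0 and second component 0.\<close>
  define f where "f g = (case the_inv code g of (a, b, w, c) \<Rightarrow> (restr y a, b))" for g
  have f_code: "f (code (a, b, w, c)) = (restr y a, b)" for a b w c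
    by (simp add: f_def the_inv_f_f[OF inj_code])
  show ?thesis
  proof (rule countable_rcosets)
    show "subgroup (normalizer ?G H) ?G"
      by (rule normalizer_imp_subgroup[OF H])
    have "f ` carrier ?G \<subseteq> restr y ` A \<times> {b. finblock b}"
    proof (rule image_subsetI)
      fix g assume "g \<in> carrier ?G"
      then show "f g \<in> restr y ` A \<times> {b. finblock b}"
        by (rule quad_group_carrierE) (simp add: f_code)
    qed
    then show "countable (f ` carrier ?G)"
      by (rule countable_subset) (intro countable_SIGMA countable countable_finblock)
  next
    fix g h assume gh: "g \<in> carrier ?G" "h \<in> carrier ?G" and eq: "f g = f h"
    define z where "z = g \<otimes>\<^bsub>?G\<^esub> inv\<^bsub>?G\<^esub> h"
    have z: "z \<in> carrier ?G" "z \<otimes>\<^bsub>?G\<^esub> h = g"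
      using gh by (simp_all add: z_def m_assoc)
    obtain a b w c where z': "z = code (a, b, w, c)"
      using z(1) by (rule quad_group_carrierE)
    obtain a' b' w' c' where h': "h = code (a', b', w', c')"
      using gh(2) by (rule quad_group_carrierE)
    have "f g = (restr y (a + a'), b + b')"
      by (simp only: z(2)[symmetric] z' h' quad_group_mult mul.simps f_code)
    then have *: "restr y a + restr y a' = restr y a'" "b + b' = b'"
      using eq by (simp_all only: h' f_code prod.inject restr_add)
    then have "restr y a + restr y a' = 0 + restr y a'" "b + b' = 0 + b'"
      by (simp_all only: add_0_left)
    then have a: "restr y a = 0" and b: "b = 0"
      by (simp_all only: add_right_cancel)
    have "z \<in> normalizer ?G H"
    proof (rule centralizing_in_normalizer[OF H z(1)])
      fix k assume k: "k \<in> H"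
      then have "k \<in> carrier ?G"
        using H by blast
      then obtain a'' b'' w'' c'' where k': "k = code (a'', b'', w'', c'')"
        by (rule quad_group_carrierE)
      \<comment> \<open>Blocks with \<open>b'' m = 0\<close> do not enter \<open>pair\<close>; in
        the others \<open>b'' m\<close> is \<open>y m\<close>, which \<open>a m\<close>
        annihilates.\<close>
      have "dot m (a m) (b'' m) = 0" if "b'' m \<noteq> 0" for m
        using y[OF k[unfolded k'] that] fun_cong[OF a, of m] by (simp add: restr_def)
      then have "pair a b'' = 0"
        unfolding pair_def by (intro sum.neutral) blast
      then show "z \<otimes>\<^bsub>?G\<^esub> k = k \<otimes>\<^bsub>?G\<^esub> z"
        unfolding z' k' quad_group_mult code_eq_iff mul_commute_iff b
        by (simp only: outer_zero pair_zero simp_thms)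
    qed
    then show "g \<otimes>\<^bsub>?G\<^esub> inv\<^bsub>?G\<^esub> h \<in> normalizer ?G H"
      by (simp only: z_def)
  qed
qed

theorem theoremA:
  assumes CH: "ctwo ^c natLeq =o cardSuc natLeq"
  shows "\<exists>G :: nat set monoid.
           fc_group G \<and>
           |carrier (G Mod center G)| =o cardSuc natLeq \<and>
           (\<forall>A. subgroup A G \<and> comm_group (G\<lparr>carrier := A\<rparr>) \<longrightarrow>
                |rcosets\<^bsub>G\<^esub> (normalizer G A)| \<le>o natLeq)"
proof -
  obtain A where A: "uncountable A" "0 \<in> A" "\<And>a b. a \<in> A \<Longrightarrow> b \<in> A \<Longrightarrow> a + b \<in> A"
    "\<And>a. a \<in> A \<Longrightarrow> block_fun a" "\<And>y. countable (restr y ` A)"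
    using CH_ex_functional_group[OF CH] by blast
  let ?G = "quad_group A"
  let ?Q = "carrier (?G Mod center ?G)"
  have "fc_group ?G"
    by (intro fc_group_quad_group A)
  moreover have "|?Q| =o cardSuc natLeq"
  proof (rule ordIso_iff_ordLeq[THEN iffD2], intro conjI)
    \<comment> \<open>The quotient is an image of a subset of the type \<open>nat set\<close>, so CH
      bounds it by \<open>cardSuc natLeq\<close>.\<close>
    have "?Q = (\<lambda>g. center ?G #>\<^bsub>?G\<^esub> g) ` carrier ?G"
      by (auto simp: FactGroup_def RCOSETS_def)
    then have "|?Q| \<le>o |UNIV :: nat set set|"
      using card_of_image[of _ "carrier ?G"] card_of_mono1[of "carrier ?G" UNIV]
        ordLeq_transitive by (metis subset_UNIV)
    then show "|?Q| \<le>o cardSuc natLeq"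
      by (rule ordLeq_ordIso_trans) (rule ordIso_transitive[OF card_UNIV_nat_set CH])
    have "uncountable ?Q"
      by (intro uncountable_quad_group_mod_center A)
    then have "natLeq <o |?Q|"
      by (simp add: countable_card_le_natLeq not_ordLeq_iff_ordLess card_of_Well_order natLeq_Well_order)
    then show "cardSuc natLeq \<le>o |?Q|"
      by (intro cardSuc_least natLeq_Card_order card_of_Card_order)
  qed
  moreover have "|rcosets\<^bsub>?G\<^esub> (normalizer ?G H)| \<le>o natLeq"
    if H: "subgroup H ?G" and "comm_group (?G\<lparr>carrier := H\<rparr>)" for H
  proof -
    interpret H: comm_group "?G\<lparr>carrier := H\<rparr>"
      by fact
    have "g \<otimes>\<^bsub>?G\<^esub> h = h \<otimes>\<^bsub>?G\<^esub> g" if "g \<in> H" "h \<in> H" for g h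
      using H.m_comm[of g h] that by simp
    then show ?thesis
      unfolding countable_card_le_natLeq[symmetric]
      by (intro countable_rcosets_normalizer_quad_group A subgroup.subset[OF H])
  qed
  ultimately show ?thesis
    by blast
qed

end
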